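(* Let $X$ and $Y$ be (real, Hausdorff) locally convex topological vector spaces, let $f$ be a (single-valued or multi-valued) mapping acting from $X$ to $Y$ with domain $D(f)\subseteq X$, let $\partial U^*$ be the boundary of a convex closed bounded absorbing set $U^*\subset Y^*$, and let $y\in Y$. Suppose there exists a subset $G\subseteq D(f)$ such that $f(G)$ is a convex subset of $Y$ for which either i) $f(G)$ has nonempty interior in $Y$, or ii) $f(G)$ is open (or closed) in $Y$. Suppose that for every $y^*\in\partial U^*$ there exists $x\in G$ such that, correspondingly, $$\text{i) }\ \{\langle z-y,y^*\rangle: z\in f(x)\}\cap(0,\infty)\neq\varnothing,\qquad\text{or}\qquad \text{ii) }\ \{\langle z-y,y^*\rangle: z\in f(x)\}\cap[0,\infty)\neq\varnothing .$$ Then $y\in f(G)$, i.e. there exists $x_1\in G$ with $y\in f(x_1)$ ($f(x_1)=y$ if $f$ is single-valued).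
   Context: No continuity of $f$ is assumed. A multi-valued mapping assigns to each $x\in D(f)$ a nonempty subset $f(x)\subseteq Y$; $f(G)=\bigcup_{x\in G}f(x)$. $\langle\cdot,\cdot\rangle$ is the duality pairing between $Y$ and its dual $Y^*$, and $Y^*$ carries its strong topology.
   Formalization: The subset G is assumed nonempty; this follows from the other hypotheses except in case ii) with Y = {0}, where G = ∅ would satisfy every hypothesis vacuously and make the conclusion y ∈ f(G) false. *)

theory Defs
  imports "HOL-Analysis.Analysis"
begin

section \<open>Locally convex spaces\<close>

class topological_real_vector = real_vector + topological_ab_group_add +
  assumes filterlim_scaleR_Pair:
    "filterlim (\<lambda>p. fst p *\<^sub>R snd p) (nhds (a *\<^sub>R x)) (nhds a \<times>\<^sub>F nhds x)"

text \<open>The constant \<open>convex\<close> cannot occur in a class specification, so it is unfolded here.\<close>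

class locally_convex_space = topological_real_vector + t2_space +
  assumes locally_convex_unfolded:
    "open V \<Longrightarrow> 0 \<in> V \<Longrightarrow> \<exists>W. open W \<and>
      (\<forall>x\<in>W. \<forall>y\<in>W. \<forall>u\<ge>0. \<forall>v\<ge>0. u + v = 1 \<longrightarrow> u *\<^sub>R x + v *\<^sub>R y \<in> W) \<and> 0 \<in> W \<and> W \<subseteq> V"

lemma locally_convex:
  fixes V :: "'a::locally_convex_space set"
  assumes "open V" "0 \<in> V"
  shows "\<exists>W. open W \<and> convex W \<and> 0 \<in> W \<and> W \<subseteq> V"
  using locally_convex_unfolded[OF assms] by (simp only: convex_def)

definition absorbs :: "'a::real_vector set \<Rightarrow> 'a set \<Rightarrow> bool" where
  "absorbs A B \<longleftrightarrow> (\<exists>r>0. \<forall>s. \<bar>s\<bar> \<ge> r \<longrightarrow> B \<subseteq> (*\<^sub>R) s ` A)"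

definition absorbing :: "'a::real_vector set \<Rightarrow> bool" where
  "absorbing A \<longleftrightarrow> (\<forall>x. absorbs A {x})"

text \<open>The library's \<open>bounded\<close> is the metric notion; this is the one for topological vector spaces.\<close>

definition vbounded :: "'a::{real_vector,topological_space} set \<Rightarrow> bool" where
  "vbounded B \<longleftrightarrow> (\<forall>V. open V \<longrightarrow> 0 \<in> V \<longrightarrow> absorbs V B)"

lemma tendsto_scaleR_topological_real_vector:
  fixes g :: "'b \<Rightarrow> 'a::topological_real_vector"
  assumes "(f \<longlongrightarrow> a) F" "(g \<longlongrightarrow> x) F"
  shows "((\<lambda>t. f t *\<^sub>R g t) \<longlongrightarrow> a *\<^sub>R x) F"
  using filterlim_compose[OF filterlim_scaleR_Pair filterlim_Pair[OF assms]] by simp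

lemma absorbs_Un: "absorbs V B \<Longrightarrow> absorbs V C \<Longrightarrow> absorbs V (B \<union> C)"
proof -
  assume "absorbs V B" "absorbs V C"
  then obtain r s where r: "r > 0" "\<And>t. \<bar>t\<bar> \<ge> r \<Longrightarrow> B \<subseteq> (*\<^sub>R) t ` V"
    and s: "s > 0" "\<And>t. \<bar>t\<bar> \<ge> s \<Longrightarrow> C \<subseteq> (*\<^sub>R) t ` V"
    unfolding absorbs_def by metis
  show ?thesis
    unfolding absorbs_def
  proof (intro exI[of _ "max r s"] conjI allI impI)
    show "B \<union> C \<subseteq> (*\<^sub>R) t ` V" if "max r s \<le> \<bar>t\<bar>" for t
      using r(2)[of t] s(2)[of t] that by (intro Un_least) simp_all
  qed (use r(1) in simp)
qed

lemma vbounded_Un: "vbounded B \<Longrightarrow> vbounded C \<Longrightarrow> vbounded (B \<union> C)"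
  by (simp add: vbounded_def absorbs_Un)

lemma vbounded_empty: "vbounded {}"
  by (auto simp: vbounded_def absorbs_def intro: exI[of _ 1])

lemma vbounded_singleton: "vbounded {x :: 'a::topological_real_vector}"
  unfolding vbounded_def
proof (intro allI impI)
  fix V :: "'a set" assume V: "open V" "0 \<in> V"
  have "((\<lambda>t::real. t *\<^sub>R x) \<longlongrightarrow> 0 *\<^sub>R x) (nhds 0)"
    by (rule tendsto_scaleR_topological_real_vector) (auto intro: filterlim_ident)
  then have "eventually (\<lambda>t::real. t *\<^sub>R x \<in> V) (nhds 0)"
    using V by (auto dest: topological_tendstoD)
  then obtain d where d: "d > 0" "\<And>t::real. \<bar>t\<bar> < d \<Longrightarrow> t *\<^sub>R x \<in> V"
    by (auto simp: eventually_nhds_metric)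
  show "absorbs V {x}"
    unfolding absorbs_def
  proof (intro exI[of _ "2 / d"] conjI allI impI)
    fix s assume s: "2 / d \<le> \<bar>s\<bar>"
    then have "s \<noteq> 0" using d by (auto simp: divide_simps split: if_splits)
    moreover have "\<bar>inverse s\<bar> < d"
      using s d \<open>s \<noteq> 0\<close> by (auto simp: field_simps abs_mult)
    ultimately show "{x} \<subseteq> (*\<^sub>R) s ` V"
      using d(2)[of "inverse s"] by (auto intro!: image_eqI[of _ _ "inverse s *\<^sub>R x"])
  qed (use d in auto)
qed


section \<open>The dual space with its strong topology\<close>

typedef (overloaded) 'a dual =
  "{\<phi> :: 'a::topological_real_vector \<Rightarrow> real. linear \<phi> \<and> continuous_on UNIV \<phi>}"
  morphisms dual_apply Dual
  by (rule exI[of _ "\<lambda>_. 0"]) (simp add: linear_zero)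

abbreviation pairing :: "'a::topological_real_vector \<Rightarrow> 'a dual \<Rightarrow> real" (\<open>\<langle>_, _\<rangle>\<close>) where
  "\<langle>z, \<phi>\<rangle> \<equiv> dual_apply \<phi> z"

setup_lifting type_definition_dual

lemma dual_eqI: "(\<And>z. \<langle>z, \<phi>\<rangle> = \<langle>z, \<psi>\<rangle>) \<Longrightarrow> \<phi> = \<psi>"
  by (metis dual_apply_inject ext)

instantiation dual :: (topological_real_vector) real_vector
begin

lift_definition zero_dual :: "'a dual" is "\<lambda>_. 0"
  by (simp add: linear_zero)

lift_definition plus_dual :: "'a dual \<Rightarrow> 'a dual \<Rightarrow> 'a dual" is "\<lambda>f g x. f x + g x"
  by (auto intro: linear_compose_add continuous_intros)

lift_definition minus_dual :: "'a dual \<Rightarrow> 'a dual \<Rightarrow> 'a dual" is "\<lambda>f g x. f x - g x"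
  by (auto intro: linear_compose_sub continuous_intros)

lift_definition uminus_dual :: "'a dual \<Rightarrow> 'a dual" is "\<lambda>f x. - f x"
  by (auto intro: linear_compose_neg continuous_intros)

lift_definition scaleR_dual :: "real \<Rightarrow> 'a dual \<Rightarrow> 'a dual" is "\<lambda>c f x. c * f x"
  by (auto intro: linear_compose_scale_right[where 'b=real, simplified] continuous_intros)

instance
  by standard (transfer, simp add: algebra_simps fun_eq_iff)+

end

lemmas dual_apply_simps [simp] =
  zero_dual.rep_eq plus_dual.rep_eq minus_dual.rep_eq uminus_dual.rep_eq scaleR_dual.rep_eq

instantiation dual :: (topological_real_vector) topological_space
begin

definition open_dual :: "'a dual set \<Rightarrow> bool" where
  "open_dual S \<longleftrightarrow> (\<forall>\<phi>\<in>S. \<exists>B e. vbounded B \<and> e > 0 \<and>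
     {\<psi>. \<forall>b\<in>B. \<bar>\<langle>b, \<psi>\<rangle> - \<langle>b, \<phi>\<rangle>\<bar> \<le> e} \<subseteq> S)"

instance
proof
  show "open (UNIV :: 'a dual set)"
    unfolding open_dual_def using vbounded_empty by (auto intro: exI[of _ 1])
next
  fix S T :: "'a dual set" assume ST: "open S" "open T"
  show "open (S \<inter> T)"
    unfolding open_dual_def
  proof
    fix \<phi> assume "\<phi> \<in> S \<inter> T"
    then have "\<phi> \<in> S" "\<phi> \<in> T" by auto
    obtain B e where Be: "vbounded B" "e > 0" "{\<psi>. \<forall>b\<in>B. \<bar>\<langle>b, \<psi>\<rangle> - \<langle>b, \<phi>\<rangle>\<bar> \<le> e} \<subseteq> S"
      using bspec[OF ST(1)[unfolded open_dual_def] \<open>\<phi> \<in> S\<close>] by blast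
    obtain C d where Cd: "vbounded C" "d > 0" "{\<psi>. \<forall>b\<in>C. \<bar>\<langle>b, \<psi>\<rangle> - \<langle>b, \<phi>\<rangle>\<bar> \<le> d} \<subseteq> T"
      using bspec[OF ST(2)[unfolded open_dual_def] \<open>\<phi> \<in> T\<close>] by blast
    from Be Cd show "\<exists>B e. vbounded B \<and> e > 0 \<and>
        {\<psi>. \<forall>b\<in>B. \<bar>\<langle>b, \<psi>\<rangle> - \<langle>b, \<phi>\<rangle>\<bar> \<le> e} \<subseteq> S \<inter> T"
      by (intro exI[of _ "B \<union> C"] exI[of _ "min e d"]) (auto simp: vbounded_Un subset_iff)
  qed
next
  fix K :: "'a dual set set" assume "\<forall>S\<in>K. open S"
  then show "open (\<Union>K)"
    unfolding open_dual_def by (meson Sup_upper UnionE order_trans)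
qed

end

text \<open>The set of \<open>\<psi>\<close> with \<open>\<bar>\<langle>b, \<psi> - \<phi>\<rangle>\<bar> \<le> e\<close> on \<open>B\<close> need not be open, but this one is.\<close>

lemma open_dual_basic:
  fixes \<phi> :: "'a::topological_real_vector dual"
  assumes "vbounded B"
  shows "open {\<psi>. \<exists>d<e. \<forall>b\<in>B. \<bar>\<langle>b, \<psi>\<rangle> - \<langle>b, \<phi>\<rangle>\<bar> \<le> d}"
  unfolding open_dual_def
proof
  fix \<psi> assume "\<psi> \<in> {\<psi>. \<exists>d<e. \<forall>b\<in>B. \<bar>\<langle>b, \<psi>\<rangle> - \<langle>b, \<phi>\<rangle>\<bar> \<le> d}"
  then obtain d where d: "d < e" "\<And>b. b \<in> B \<Longrightarrow> \<bar>\<langle>b, \<psi>\<rangle> - \<langle>b, \<phi>\<rangle>\<bar> \<le> d" by auto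
  have "\<exists>d<e. \<forall>b\<in>B. \<bar>\<langle>b, \<eta>\<rangle> - \<langle>b, \<phi>\<rangle>\<bar> \<le> d"
    if "\<forall>b\<in>B. \<bar>\<langle>b, \<eta>\<rangle> - \<langle>b, \<psi>\<rangle>\<bar> \<le> (e - d) / 2" for \<eta>
  proof (intro exI[of _ "(e + d) / 2"] conjI ballI)
    fix b assume "b \<in> B"
    with that d(2) have "\<bar>\<langle>b, \<eta>\<rangle> - \<langle>b, \<psi>\<rangle>\<bar> \<le> (e - d) / 2" "\<bar>\<langle>b, \<psi>\<rangle> - \<langle>b, \<phi>\<rangle>\<bar> \<le> d" by auto
    then show "\<bar>\<langle>b, \<eta>\<rangle> - \<langle>b, \<phi>\<rangle>\<bar> \<le> (e + d) / 2"
      by argo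
  qed (use d(1) in simp)
  then show "\<exists>C c. vbounded C \<and> c > 0 \<and> {\<eta>. \<forall>b\<in>C. \<bar>\<langle>b, \<eta>\<rangle> - \<langle>b, \<psi>\<rangle>\<bar> \<le> c} \<subseteq>
      {\<psi>. \<exists>d<e. \<forall>b\<in>B. \<bar>\<langle>b, \<psi>\<rangle> - \<langle>b, \<phi>\<rangle>\<bar> \<le> d}"
    using assms d(1) by (intro exI[of _ B] exI[of _ "(e - d) / 2"]) auto
qed

lemma eventually_nhds_dual:
  fixes \<phi> :: "'a::topological_real_vector dual"
  shows "eventually P (nhds \<phi>) \<longleftrightarrow>
    (\<exists>B e. vbounded B \<and> e > 0 \<and> (\<forall>\<psi>. (\<forall>b\<in>B. \<bar>\<langle>b, \<psi>\<rangle> - \<langle>b, \<phi>\<rangle>\<bar> \<le> e) \<longrightarrow> P \<psi>))"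
proof
  assume "eventually P (nhds \<phi>)"
  then obtain S where S: "open S" "\<phi> \<in> S" "\<And>\<psi>. \<psi> \<in> S \<Longrightarrow> P \<psi>"
    by (auto simp: eventually_nhds)
  then obtain B e where "vbounded B" "e > 0"
    "{\<psi>. \<forall>b\<in>B. \<bar>\<langle>b, \<psi>\<rangle> - \<langle>b, \<phi>\<rangle>\<bar> \<le> e} \<subseteq> S"
    unfolding open_dual_def by meson
  with S(3) show "\<exists>B e. vbounded B \<and> e > 0 \<and>
      (\<forall>\<psi>. (\<forall>b\<in>B. \<bar>\<langle>b, \<psi>\<rangle> - \<langle>b, \<phi>\<rangle>\<bar> \<le> e) \<longrightarrow> P \<psi>)"
    by blast
next
  assume "\<exists>B e. vbounded B \<and> e > 0 \<and> (\<forall>\<psi>. (\<forall>b\<in>B. \<bar>\<langle>b, \<psi>\<rangle> - \<langle>b, \<phi>\<rangle>\<bar> \<le> e) \<longrightarrow> P \<psi>)"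
  then obtain B e where Be: "vbounded B" "e > 0"
    "\<And>\<psi>. \<forall>b\<in>B. \<bar>\<langle>b, \<psi>\<rangle> - \<langle>b, \<phi>\<rangle>\<bar> \<le> e \<Longrightarrow> P \<psi>" by blast
  show "eventually P (nhds \<phi>)"
    unfolding eventually_nhds
  proof (intro exI conjI ballI)
    show "open {\<psi>. \<exists>d<e. \<forall>b\<in>B. \<bar>\<langle>b, \<psi>\<rangle> - \<langle>b, \<phi>\<rangle>\<bar> \<le> d}"
      by (rule open_dual_basic) fact
    show "\<phi> \<in> {\<psi>. \<exists>d<e. \<forall>b\<in>B. \<bar>\<langle>b, \<psi>\<rangle> - \<langle>b, \<phi>\<rangle>\<bar> \<le> d}"
      using Be(2) by (auto intro: exI[of _ 0])
    show "P \<psi>" if "\<psi> \<in> {\<psi>. \<exists>d<e. \<forall>b\<in>B. \<bar>\<langle>b, \<psi>\<rangle> - \<langle>b, \<phi>\<rangle>\<bar> \<le> d}" for \<psi>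
      using that Be(3)[of \<psi>] by force
  qed
qed

lemma tendsto_dual_iff:
  fixes \<phi> :: "'a::topological_real_vector dual"
  shows "(f \<longlongrightarrow> \<phi>) F \<longleftrightarrow>
    (\<forall>B e. vbounded B \<longrightarrow> e > 0 \<longrightarrow> eventually (\<lambda>t. \<forall>b\<in>B. \<bar>\<langle>b, f t\<rangle> - \<langle>b, \<phi>\<rangle>\<bar> \<le> e) F)"
    (is "_ = ?R")
proof
  assume lim: "(f \<longlongrightarrow> \<phi>) F"
  show ?R
  proof (intro allI impI)
    fix B :: "'a set" and e :: real assume "vbounded B" "e > 0"
    then have "eventually (\<lambda>\<psi>. \<forall>b\<in>B. \<bar>\<langle>b, \<psi>\<rangle> - \<langle>b, \<phi>\<rangle>\<bar> \<le> e) (nhds \<phi>)"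
      unfolding eventually_nhds_dual by blast
    with lim show "eventually (\<lambda>t. \<forall>b\<in>B. \<bar>\<langle>b, f t\<rangle> - \<langle>b, \<phi>\<rangle>\<bar> \<le> e) F"
      by (rule eventually_compose_filterlim[rotated])
  qed
next
  assume R: ?R
  show "(f \<longlongrightarrow> \<phi>) F"
    unfolding filterlim_iff
  proof (intro allI impI)
    fix P assume "eventually P (nhds \<phi>)"
    then obtain B e where Be: "vbounded B" "e > 0"
      "\<And>\<psi>. \<forall>b\<in>B. \<bar>\<langle>b, \<psi>\<rangle> - \<langle>b, \<phi>\<rangle>\<bar> \<le> e \<Longrightarrow> P \<psi>" unfolding eventually_nhds_dual by blast
    have "eventually (\<lambda>t. \<forall>b\<in>B. \<bar>\<langle>b, f t\<rangle> - \<langle>b, \<phi>\<rangle>\<bar> \<le> e) F" using R Be by blast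
    then show "eventually (\<lambda>t. P (f t)) F"
      by eventually_elim (rule Be(3))
  qed
qed

lemma dual_bounded_on:
  fixes \<phi> :: "'a::topological_real_vector dual"
  assumes "vbounded B"
  obtains r where "r > 0" "\<And>b. b \<in> B \<Longrightarrow> \<bar>\<langle>b, \<phi>\<rangle>\<bar> \<le> r"
proof -
  have lin: "linear (dual_apply \<phi>)" and cont: "continuous_on UNIV (dual_apply \<phi>)"
    using dual_apply[of \<phi>] by auto
  let ?V = "{x. \<bar>\<langle>x, \<phi>\<rangle>\<bar> < 1}"
  have "open ?V"
    by (intro open_Collect_less continuous_intros cont)
  moreover have "0 \<in> ?V" by (simp add: linear_0[OF lin])
  ultimately obtain r where r: "r > 0" "\<And>s. \<bar>s\<bar> \<ge> r \<Longrightarrow> B \<subseteq> (*\<^sub>R) s ` ?V"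
    using assms unfolding vbounded_def absorbs_def by metis
  have "\<bar>\<langle>b, \<phi>\<rangle>\<bar> \<le> r" if "b \<in> B" for b
  proof -
    from r(2)[of r] r(1) that obtain v where "v \<in> ?V" "b = r *\<^sub>R v" by auto
    then show ?thesis using r(1) by (simp add: linear_scale[OF lin] abs_mult)
  qed
  with r(1) show ?thesis by (rule that)
qed

instance dual :: (topological_real_vector) topological_real_vector
proof
  fix \<phi> \<psi> :: "'a dual" and a :: real
  have near: "eventually (\<lambda>p. \<forall>b\<in>B. \<bar>\<langle>b, fst p\<rangle> - \<langle>b, \<phi>\<rangle>\<bar> \<le> e) (nhds \<phi> \<times>\<^sub>F G)"
    if "vbounded B" "e > 0" for B e and \<phi> :: "'a dual" and G :: "'c filter"
  proof -
    have "(fst \<longlongrightarrow> \<phi>) (nhds \<phi> \<times>\<^sub>F G)" by (rule filterlim_fst)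
    with that show ?thesis unfolding tendsto_dual_iff by blast
  qed
  have near': "eventually (\<lambda>p. \<forall>b\<in>B. \<bar>\<langle>b, snd p\<rangle> - \<langle>b, \<phi>\<rangle>\<bar> \<le> e) (G \<times>\<^sub>F nhds \<phi>)"
    if "vbounded B" "e > 0" for B e and \<phi> :: "'a dual" and G :: "'c filter"
  proof -
    have "(snd \<longlongrightarrow> \<phi>) (G \<times>\<^sub>F nhds \<phi>)" by (rule filterlim_snd)
    with that show ?thesis unfolding tendsto_dual_iff by blast
  qed
  show "((\<lambda>p. fst p + snd p) \<longlongrightarrow> \<phi> + \<psi>) (nhds \<phi> \<times>\<^sub>F nhds \<psi>)"
    unfolding tendsto_dual_iff
  proof (intro allI impI)
    fix B :: "'a set" and e :: real assume B: "vbounded B" and e: "e > 0"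
    have "e / 2 > 0" using e by simp
    from near[OF B this] near'[OF B this]
    show "eventually (\<lambda>p. \<forall>b\<in>B. \<bar>\<langle>b, fst p + snd p\<rangle> - \<langle>b, \<phi> + \<psi>\<rangle>\<bar> \<le> e) (nhds \<phi> \<times>\<^sub>F nhds \<psi>)"
    proof eventually_elim
      case (elim p)
      show ?case
      proof
        fix b assume "b \<in> B"
        with elim have "\<bar>\<langle>b, fst p\<rangle> - \<langle>b, \<phi>\<rangle>\<bar> \<le> e / 2" "\<bar>\<langle>b, snd p\<rangle> - \<langle>b, \<psi>\<rangle>\<bar> \<le> e / 2" by auto
        then show "\<bar>\<langle>b, fst p + snd p\<rangle> - \<langle>b, \<phi> + \<psi>\<rangle>\<bar> \<le> e"
          unfolding dual_apply_simps by linarith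
      qed
    qed
  qed
  show "(uminus \<longlongrightarrow> - \<phi>) (nhds \<phi>)"
  proof -
    have "((\<lambda>x. x) \<longlongrightarrow> \<phi>) (nhds \<phi>)" by (rule filterlim_ident)
    then show ?thesis
      unfolding tendsto_dual_iff by (simp add: abs_minus_commute)
  qed
  show "((\<lambda>p. fst p *\<^sub>R snd p) \<longlongrightarrow> a *\<^sub>R \<phi>) (nhds a \<times>\<^sub>F nhds \<phi>)"
    unfolding tendsto_dual_iff
  proof (intro allI impI)
    fix B :: "'a set" and e :: real assume B: "vbounded B" and e: "e > 0"
    obtain r where r: "r > 0" "\<And>b. b \<in> B \<Longrightarrow> \<bar>\<langle>b, \<phi>\<rangle>\<bar> \<le> r"
      using dual_bounded_on[OF B, of \<phi>] by blast
    define d where "d = min 1 (e / (2 * r))"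
    define c where "c = e / (2 * (\<bar>a\<bar> + 1))"
    have d: "d > 0" "d \<le> 1" "d * r \<le> e / 2"
      using r(1) e by (auto simp: d_def min_def field_simps)
    have c: "c > 0" "(\<bar>a\<bar> + 1) * c = e / 2"
      using e by (auto simp: c_def field_simps)
    have "(fst \<longlongrightarrow> a) (nhds a \<times>\<^sub>F nhds \<phi>)" by (rule filterlim_fst)
    then have "eventually (\<lambda>p. dist (fst p) a < d) (nhds a \<times>\<^sub>F nhds \<phi>)"
      using d(1) by (rule tendstoD)
    with near'[OF B c(1)]
    show "eventually (\<lambda>p. \<forall>b\<in>B. \<bar>\<langle>b, fst p *\<^sub>R snd p\<rangle> - \<langle>b, a *\<^sub>R \<phi>\<rangle>\<bar> \<le> e) (nhds a \<times>\<^sub>F nhds \<phi>)"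
    proof eventually_elim
      case (elim p)
      show ?case
      proof
        fix b assume b: "b \<in> B"
        let ?s = "fst p" and ?x = "\<langle>b, snd p\<rangle>" and ?y = "\<langle>b, \<phi>\<rangle>"
        have s: "\<bar>?s - a\<bar> \<le> d" using elim by (simp add: dist_real_def)
        have "\<bar>?s * ?x - a * ?y\<bar> = \<bar>?s * (?x - ?y) + (?s - a) * ?y\<bar>"
          by (simp add: algebra_simps)
        also have "\<dots> \<le> \<bar>?s\<bar> * \<bar>?x - ?y\<bar> + \<bar>?s - a\<bar> * \<bar>?y\<bar>"
          by (metis abs_mult abs_triangle_ineq)
        also have "\<dots> \<le> (\<bar>a\<bar> + 1) * c + d * r"
          using elim b s d r(2)[OF b] c(1) by (intro add_mono mult_mono) auto
        also have "\<dots> \<le> e" using d c by simp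
        finally show "\<bar>\<langle>b, ?s *\<^sub>R snd p\<rangle> - \<langle>b, a *\<^sub>R \<phi>\<rangle>\<bar> \<le> e" by simp
      qed
    qed
  qed
qed

instance dual :: (topological_real_vector) locally_convex_space
proof
  fix \<phi> \<psi> :: "'a dual" assume "\<phi> \<noteq> \<psi>"
  then obtain b where b: "\<langle>b, \<phi>\<rangle> \<noteq> \<langle>b, \<psi>\<rangle>" using dual_eqI by blast
  define e where "e = \<bar>\<langle>b, \<phi>\<rangle> - \<langle>b, \<psi>\<rangle>\<bar> / 3"
  have e: "e > 0" using b by (simp add: e_def)
  have near: "eventually (\<lambda>\<eta>. \<bar>\<langle>b, \<eta>\<rangle> - \<langle>b, \<zeta>\<rangle>\<bar> \<le> e) (nhds \<zeta>)" for \<zeta> :: "'a dual"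
    unfolding eventually_nhds_dual using vbounded_singleton[of b] e by blast
  from near[of \<phi>] near[of \<psi>] obtain S T where
    S: "open S" "\<phi> \<in> S" "\<And>\<eta>. \<eta> \<in> S \<Longrightarrow> \<bar>\<langle>b, \<eta>\<rangle> - \<langle>b, \<phi>\<rangle>\<bar> \<le> e" and
    T: "open T" "\<psi> \<in> T" "\<And>\<eta>. \<eta> \<in> T \<Longrightarrow> \<bar>\<langle>b, \<eta>\<rangle> - \<langle>b, \<psi>\<rangle>\<bar> \<le> e"
    unfolding eventually_nhds by blast
  have "S \<inter> T = {}"
  proof (rule ccontr)
    assume "S \<inter> T \<noteq> {}"
    then obtain \<eta> where "\<eta> \<in> S" "\<eta> \<in> T" by blast
    then have "\<bar>\<langle>b, \<eta>\<rangle> - \<langle>b, \<phi>\<rangle>\<bar> \<le> e" "\<bar>\<langle>b, \<eta>\<rangle> - \<langle>b, \<psi>\<rangle>\<bar> \<le> e" using S T by auto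
    then have "\<bar>\<langle>b, \<phi>\<rangle> - \<langle>b, \<psi>\<rangle>\<bar> \<le> 2 * e" by linarith
    moreover have "\<bar>\<langle>b, \<phi>\<rangle> - \<langle>b, \<psi>\<rangle>\<bar> = 3 * e" by (simp add: e_def)
    ultimately show False using e by simp
  qed
  with S T show "\<exists>U V. open U \<and> open V \<and> \<phi> \<in> U \<and> \<psi> \<in> V \<and> U \<inter> V = {}" by blast
next
  fix V :: "'a dual set" assume "open V" "0 \<in> V"
  then obtain B e where Be: "vbounded B" "e > 0"
    "{\<psi>. \<forall>b\<in>B. \<bar>\<langle>b, \<psi>\<rangle> - \<langle>b, 0\<rangle>\<bar> \<le> e} \<subseteq> V"
    unfolding open_dual_def by meson
  let ?W = "{\<psi>. \<exists>d<e. \<forall>b\<in>B. \<bar>\<langle>b, \<psi>\<rangle> - \<langle>b, 0\<rangle>\<bar> \<le> d}"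
  have "convex ?W"
    unfolding convex_def
  proof (intro ballI allI impI)
    fix \<phi> \<psi> :: "'a dual" and u v :: real
    assume "\<phi> \<in> ?W" "\<psi> \<in> ?W" and uv: "0 \<le> u" "0 \<le> v" "u + v = 1"
    then obtain c d where c: "c < e" "\<And>b. b \<in> B \<Longrightarrow> \<bar>\<langle>b, \<phi>\<rangle>\<bar> \<le> c"
      and d: "d < e" "\<And>b. b \<in> B \<Longrightarrow> \<bar>\<langle>b, \<psi>\<rangle>\<bar> \<le> d" by auto
    have "\<bar>u * \<langle>b, \<phi>\<rangle> + v * \<langle>b, \<psi>\<rangle>\<bar> \<le> max c d" if "b \<in> B" for b
    proof -
      have "\<bar>u * \<langle>b, \<phi>\<rangle> + v * \<langle>b, \<psi>\<rangle>\<bar> \<le> u * \<bar>\<langle>b, \<phi>\<rangle>\<bar> + v * \<bar>\<langle>b, \<psi>\<rangle>\<bar>"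
        using uv by (metis abs_mult abs_of_nonneg abs_triangle_ineq)
      also have "\<dots> \<le> u * max c d + v * max c d"
        using uv c(2)[OF that] d(2)[OF that] by (intro add_mono mult_left_mono) auto
      also have "\<dots> = max c d" using uv by (metis distrib_right mult_1)
      finally show ?thesis .
    qed
    then show "u *\<^sub>R \<phi> + v *\<^sub>R \<psi> \<in> ?W"
      using c(1) d(1) by (auto intro!: exI[of _ "max c d"])
  qed
  moreover have "open ?W" using Be(1) by (rule open_dual_basic)
  moreover have "0 \<in> ?W" using Be(2) by (auto intro: exI[of _ 0])
  moreover have "?W \<subseteq> V" using Be(3) by force
  ultimately show "\<exists>W. open W \<and>
      (\<forall>\<phi>\<in>W. \<forall>\<psi>\<in>W. \<forall>u\<ge>0. \<forall>v\<ge>0. u + v = 1 \<longrightarrow> u *\<^sub>R \<phi> + v *\<^sub>R \<psi> \<in> W) \<and> 0 \<in> W \<and> W \<subseteq> V"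
    unfolding convex_def by blast
qed


section \<open>Multi-valued mappings\<close>

text \<open>
  A mapping with domain \<open>D\<close> is a set-valued function together with \<open>D\<close>; its values off \<open>D\<close> are
  irrelevant. A single-valued mapping is one all of whose values on \<open>D\<close> are singletons.
\<close>

definition multimap_on :: "'a set \<Rightarrow> ('a \<Rightarrow> 'b set) \<Rightarrow> bool" where
  "multimap_on D f \<longleftrightarrow> (\<forall>x\<in>D. f x \<noteq> {})"

definition single_valued_on :: "'a set \<Rightarrow> ('a \<Rightarrow> 'b set) \<Rightarrow> bool" where
  "single_valued_on D f \<longleftrightarrow> (\<forall>x\<in>D. \<exists>z. f x = {z})"

definition multi_image :: "('a \<Rightarrow> 'b set) \<Rightarrow> 'a set \<Rightarrow> 'b set" where
  "multi_image f G = (\<Union>x\<in>G. f x)"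

end

theory Submission
  imports Defs
begin

text \<open>
  If \<open>y\<close> were outside the convex set \<open>f(G)\<close>, Hahn--Banach would give a nonzero continuous functional
  \<open>\<phi>\<close> with \<open>\<langle>z - y, \<phi>\<rangle> \<le> 0\<close> for all \<open>z \<in> f(G)\<close>, strictly if \<open>f(G)\<close> is open or closed. Since \<open>U\<close>
  is closed, bounded and absorbing, the ray through \<open>\<phi>\<close> meets \<open>\<partial>U\<close> at a positive multiple of \<open>\<phi>\<close>,
  which contradicts the hypothesis. Hahn--Banach itself needs no extension from subspaces:
  a sublinear functional that is minimal for the pointwise order is linear.
\<close>

section \<open>Sublinear functionals\<close>

text \<open>The inequality in the second clause already forces equality and \<open>p 0 = 0\<close>.\<close>

definition sublinear :: "('a::real_vector \<Rightarrow> real) \<Rightarrow> bool" where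
  "sublinear p \<longleftrightarrow> (\<forall>x y. p (x + y) \<le> p x + p y) \<and> (\<forall>t>0. \<forall>x. p (t *\<^sub>R x) \<le> t * p x)"

lemma sublinear_add: "sublinear p \<Longrightarrow> p (x + y) \<le> p x + p y"
  by (simp add: sublinear_def)

lemma sublinear_scaleR_pos:
  assumes "sublinear p" "t > 0"
  shows "p (t *\<^sub>R x) = t * p x"
proof (rule antisym)
  have "p (inverse t *\<^sub>R t *\<^sub>R x) \<le> inverse t * p (t *\<^sub>R x)"
    using assms unfolding sublinear_def by (meson inverse_positive_iff_positive)
  then show "t * p x \<le> p (t *\<^sub>R x)"
    using assms(2) by (simp add: field_simps)
qed (use assms in \<open>simp add: sublinear_def\<close>)

lemma sublinear_zero: "sublinear p \<Longrightarrow> p 0 = 0"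
  using sublinear_scaleR_pos[of p 2 0] by simp

lemma sublinear_scaleR:
  assumes "sublinear p" "t \<ge> 0"
  shows "p (t *\<^sub>R x) = t * p x"
  using sublinear_scaleR_pos[OF assms(1), of t x] sublinear_zero[OF assms(1)] assms(2)
  by (cases "t = 0") auto

lemma sublinear_minus: "sublinear p \<Longrightarrow> - p (- x) \<le> p x"
  using sublinear_add[of p x "- x"] sublinear_zero[of p] by simp

text \<open>Lowers \<open>p\<close> as far as possible in the direction \<open>- x\<close>.\<close>

lemma sublinear_lower:
  assumes p: "sublinear p"
  obtains q where "sublinear q" "q \<le> p" "q (- x) \<le> - p x"
proof -
  define g where "g z t = p (z + t *\<^sub>R x) - t * p x" for z t
  define q where "q z = (INF t\<in>{0..}. g z t)" for z
  have bdd: "bdd_below (g z ` {0..})" for z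
  proof (rule bdd_belowI2)
    fix t :: real assume "t \<in> {0..}"
    then have "t * p x = p (t *\<^sub>R x)" by (simp add: sublinear_scaleR[OF p])
    also have "\<dots> \<le> p (z + t *\<^sub>R x) + p (- z)"
      using sublinear_add[OF p, of "z + t *\<^sub>R x" "- z"] by simp
    finally show "- p (- z) \<le> g z t" by (simp add: g_def)
  qed
  have q_le: "q z \<le> g z t" if "t \<ge> 0" for z t
    unfolding q_def using that by (intro cINF_lower bdd) simp
  have le_q: "c \<le> q z" if "\<And>t. t \<ge> 0 \<Longrightarrow> c \<le> g z t" for c z
    unfolding q_def using that by (intro cINF_greatest) auto
  have "q (z + w) \<le> q z + q w" for z w
  proof -
    have "q (z + w) \<le> g z s + g w t" if "s \<ge> 0" "t \<ge> 0" for s t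
    proof -
      have "q (z + w) \<le> g (z + w) (s + t)" using that by (intro q_le) simp
      also have "\<dots> \<le> g z s + g w t"
        using sublinear_add[OF p, of "z + s *\<^sub>R x" "w + t *\<^sub>R x"]
        by (simp add: g_def algebra_simps)
      finally show ?thesis .
    qed
    then have "q (z + w) - g w t \<le> q z" if "t \<ge> 0" for t
      using that by (intro le_q) (simp add: algebra_simps)
    then have "q (z + w) - q z \<le> q w" by (intro le_q) (simp add: algebra_simps)
    then show ?thesis by simp
  qed
  moreover have "q (c *\<^sub>R z) \<le> c * q z" if c: "c > 0" for c z
  proof -
    have "q (c *\<^sub>R z) / c \<le> g z t" if "t \<ge> 0" for t
    proof -
      have "q (c *\<^sub>R z) \<le> g (c *\<^sub>R z) (c * t)" using that c by (intro q_le) simp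
      also have "\<dots> = c * g z t"
        using sublinear_scaleR_pos[OF p c, of "z + t *\<^sub>R x"] by (simp add: g_def algebra_simps)
      finally show ?thesis using c by (simp add: field_simps)
    qed
    then have "q (c *\<^sub>R z) / c \<le> q z" by (rule le_q)
    then show ?thesis using c by (simp add: field_simps)
  qed
  ultimately have "sublinear q" by (simp add: sublinear_def)
  moreover have "q \<le> p" using q_le[of 0] by (simp add: le_fun_def g_def)
  moreover have "q (- x) \<le> - p x"
    using q_le[of 1 "- x"] sublinear_zero[OF p] by (simp add: g_def)
  ultimately show thesis by (rule that)
qed

lemma sublinear_INF_chain:
  assumes "C \<noteq> {}" and sub: "\<And>q. q \<in> C \<Longrightarrow> sublinear q \<and> q \<le> p"
    and chain: "\<And>q r. q \<in> C \<Longrightarrow> r \<in> C \<Longrightarrow> q \<le> r \<or> r \<le> q"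
  obtains u where "sublinear u" "\<And>q. q \<in> C \<Longrightarrow> u \<le> q"
proof -
  define u where "u x = (INF q\<in>C. q x)" for x
  have bdd: "bdd_below ((\<lambda>q. q x) ` C)" for x
  proof (rule bdd_belowI2)
    fix q assume "q \<in> C"
    then show "- p (- x) \<le> q x"
      using sub[of q] sublinear_minus[of q x] by (force simp: le_fun_def intro: order_trans[rotated])
  qed
  have u_le: "u x \<le> q x" if "q \<in> C" for q x
    unfolding u_def using that by (intro cINF_lower bdd)
  have le_u: "c \<le> u x" if "\<And>q. q \<in> C \<Longrightarrow> c \<le> q x" for c x
    unfolding u_def using that assms(1) by (intro cINF_greatest)
  have "u (x + y) \<le> u x + u y" for x y
  proof -
    have "u (x + y) \<le> q x + r y" if q: "q \<in> C" and r: "r \<in> C" for q r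
    proof -
      have *: "u (x + y) \<le> s x + s y" if "s \<in> C" for s
        using u_le[OF that, of "x + y"] sub[OF that] sublinear_add[of s x y] by linarith
      show ?thesis
        using chain[OF q r] *[OF q] *[OF r] le_funD[of q r y] le_funD[of r q x] by linarith
    qed
    then have "u (x + y) - r y \<le> u x" if "r \<in> C" for r
      using that by (intro le_u) (simp add: algebra_simps)
    then have "u (x + y) - u x \<le> u y" by (intro le_u) (simp add: algebra_simps)
    then show ?thesis by simp
  qed
  moreover have "u (c *\<^sub>R x) \<le> c * u x" if c: "c > 0" for c x
  proof -
    have "u (c *\<^sub>R x) / c \<le> q x" if "q \<in> C" for q
      using u_le[OF that, of "c *\<^sub>R x"] sub[OF that] sublinear_scaleR_pos[of q c x] c
      by (simp add: field_simps)
    then have "u (c *\<^sub>R x) / c \<le> u x" by (rule le_u)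
    then show ?thesis using c by (simp add: field_simps)
  qed
  ultimately have "sublinear u" by (simp add: sublinear_def)
  with u_le show thesis by (intro that) (auto simp: le_fun_def)
qed

theorem Hahn_Banach_sublinear:
  assumes p: "sublinear p"
  obtains f where "linear f" "f \<le> p"
proof -
  define S where "S = {q. sublinear q \<and> q \<le> p}"
  have "\<exists>m\<in>S. \<forall>q\<in>S. q \<le> m \<longrightarrow> q = m"
  proof (rule predicate_Zorn)
    show "partial_order_on S (relation_of (\<lambda>q r. r \<le> q) S)"
      by (rule partial_order_on_relation_ofI) auto
    fix C assume C: "C \<in> Chains (relation_of (\<lambda>q r. r \<le> q) S)"
    show "\<exists>u\<in>S. \<forall>q\<in>C. u \<le> q"
    proof (cases "C = {}")
      case True
      then show ?thesis using p by (auto simp: S_def)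
    next
      case False
      have CS: "q \<in> S" if "q \<in> C" for q
        using C that by (auto simp: Chains_def relation_of_def)
      have "q \<le> r \<or> r \<le> q" if "q \<in> C" "r \<in> C" for q r
        using C that by (auto simp: Chains_def relation_of_def)
      then obtain u where u: "sublinear u" "\<And>q. q \<in> C \<Longrightarrow> u \<le> q"
        using sublinear_INF_chain[OF False, of p] CS unfolding S_def by blast
      moreover have "u \<le> p" using False u(2) CS by (auto simp: S_def intro: order_trans)
      ultimately show ?thesis by (auto simp: S_def)
    qed
  qed
  then obtain m where m: "sublinear m" "m \<le> p" and min: "\<And>q. sublinear q \<Longrightarrow> q \<le> m \<Longrightarrow> q = m"
    unfolding S_def by (blast intro: order_trans)
  have minus: "m (- x) = - m x" for x
    using sublinear_lower[OF m(1), of x] min sublinear_minus[OF m(1), of x]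
    by (metis antisym minus_le_iff)
  have "linear m"
  proof (rule linearI)
    fix x y
    show "m (x + y) = m x + m y"
      using sublinear_add[OF m(1), of x y] sublinear_add[OF m(1), of "- x" "- y"]
        minus[of x] minus[of y] minus[of "x + y"] by simp
  next
    fix c x
    show "m (c *\<^sub>R x) = c *\<^sub>R m x"
      using sublinear_scaleR[OF m(1), of c x] sublinear_scaleR[OF m(1), of "- c" x]
        minus[of "c *\<^sub>R x"] by (cases "c \<ge> 0") simp_all
  qed
  with m(2) show thesis by (rule that[rotated])
qed

lemma Hahn_Banach_sublinear_at:
  assumes p: "sublinear p"
  obtains f where "linear f" "f \<le> p" "p x \<le> f x"
proof -
  obtain q where q: "sublinear q" "q \<le> p" "q (- x) \<le> - p x"
    using sublinear_lower[OF p] .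
  obtain f where f: "linear f" "f \<le> q" using Hahn_Banach_sublinear[OF q(1)] .
  have "f (- x) \<le> - p x" using f(2) q(3) le_funD order_trans by metis
  then have "p x \<le> f x" by (simp add: linear_neg[OF f(1)])
  with f q(2) show thesis by (intro that) auto
qed


section \<open>Separation in topological vector spaces\<close>

lemma continuous_on_scaleR_tvs:
  fixes g :: "'b::topological_space \<Rightarrow> 'a::topological_real_vector"
  assumes "continuous_on S f" "continuous_on S g"
  shows "continuous_on S (\<lambda>t. f t *\<^sub>R g t)"
  using assms unfolding continuous_on_def by (blast intro: tendsto_scaleR_topological_real_vector)

lemma open_affine_image_tvs:
  fixes S :: "'a::topological_real_vector set"
  assumes "open S" "c \<noteq> 0"
  shows "open ((\<lambda>x. a + c *\<^sub>R x) ` S)"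
proof -
  have "(\<lambda>x. a + c *\<^sub>R x) ` S = (\<lambda>x. inverse c *\<^sub>R (x - a)) -` S"
    using assms(2) by (force simp: image_iff)
  also have "open \<dots>"
    by (intro open_vimage assms continuous_on_scaleR_tvs continuous_intros)
  finally show ?thesis .
qed

lemma open_real_line_tvs:
  fixes V :: "'a::topological_real_vector set"
  assumes "open V"
  shows "open {t::real. t *\<^sub>R x \<in> V}"
proof -
  have "open ((\<lambda>t::real. t *\<^sub>R x) -` V)"
    by (intro open_vimage assms continuous_on_scaleR_tvs continuous_intros)
  then show ?thesis by (simp add: vimage_def)
qed

lemma sublinear_gauge:
  fixes W :: "'a::topological_real_vector set"
  assumes W: "open W" "convex W" "0 \<in> W"
  obtains p where "sublinear p" "\<And>x. x \<in> W \<longleftrightarrow> p x < 1"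
proof -
  define A where "A x = {r. r > 0 \<and> inverse r *\<^sub>R x \<in> W}" for x
  define p where "p x = Inf (A x)" for x
  have nonempty: "A x \<noteq> {}" for x
  proof -
    have "0 \<in> {t::real. t *\<^sub>R x \<in> W}" using W(3) by simp
    then obtain e where e: "e > 0" "ball 0 e \<subseteq> {t::real. t *\<^sub>R x \<in> W}"
      using open_real_line_tvs[OF W(1)] open_contains_ball by blast
    have "e / 2 \<in> ball 0 e" using e(1) by simp
    with e(2) have "(e / 2) *\<^sub>R x \<in> W" by blast
    with e(1) have "inverse (e / 2) \<in> A x" by (simp add: A_def)
    then show ?thesis by blast
  qed
  have bdd: "bdd_below (A x)" for x
    by (rule bdd_belowI[of _ 0]) (simp add: A_def)
  have p_le: "p x \<le> r" if "r \<in> A x" for x r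
    unfolding p_def using that by (intro cInf_lower bdd)
  have le_p: "c \<le> p x" if "\<And>r. r \<in> A x \<Longrightarrow> c \<le> r" for c x
    unfolding p_def using that nonempty by (intro cInf_greatest)
  have "p (x + y) \<le> p x + p y" for x y
  proof -
    have "p (x + y) \<le> r + s" if r: "r \<in> A x" and s: "s \<in> A y" for r s
    proof (rule p_le)
      have "(r / (r + s)) *\<^sub>R (inverse r *\<^sub>R x) + (s / (r + s)) *\<^sub>R (inverse s *\<^sub>R y) \<in> W"
        using r s by (intro convexD[OF W(2)]) (auto simp: A_def add_divide_distrib[symmetric])
      then show "r + s \<in> A (x + y)"
        using r s by (simp add: A_def scaleR_add_right inverse_eq_divide)
    qed
    then have "p (x + y) - s \<le> p x" if "s \<in> A y" for s
      using that by (intro le_p) (simp add: algebra_simps)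
    then have "p (x + y) - p x \<le> p y" by (intro le_p) (simp add: algebra_simps)
    then show ?thesis by simp
  qed
  moreover have "p (c *\<^sub>R x) \<le> c * p x" if c: "c > 0" for c x
  proof -
    have "p (c *\<^sub>R x) / c \<le> r" if "r \<in> A x" for r
    proof -
      have "c * r \<in> A (c *\<^sub>R x)" using that c by (simp add: A_def field_simps)
      then show ?thesis using p_le c by (simp add: field_simps)
    qed
    then have "p (c *\<^sub>R x) / c \<le> p x" by (rule le_p)
    then show ?thesis using c by (simp add: field_simps)
  qed
  ultimately have "sublinear p" by (simp add: sublinear_def)
  moreover have "x \<in> W \<longleftrightarrow> p x < 1" for x
  proof
    assume "x \<in> W"
    then have "1 \<in> {t::real. t *\<^sub>R x \<in> W}" by simp
    then obtain e where e: "e > 0" "ball 1 e \<subseteq> {t::real. t *\<^sub>R x \<in> W}"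
      using open_real_line_tvs[OF W(1)] open_contains_ball by blast
    moreover have "1 + e / 2 \<in> ball 1 e" using e(1) by (simp add: dist_real_def)
    ultimately have "inverse (1 + e / 2) \<in> A x" unfolding A_def inverse_inverse_eq by auto
    then have "p x \<le> inverse (1 + e / 2)" by (rule p_le)
    also have "\<dots> < 1" using e(1) by (simp add: field_simps)
    finally show "p x < 1" .
  next
    assume "p x < 1"
    then obtain r where r: "r \<in> A x" "r < 1" using le_p[of x 1] by fastforce
    then have "r *\<^sub>R (inverse r *\<^sub>R x) + (1 - r) *\<^sub>R 0 \<in> W"
      using W(3) by (intro convexD[OF W(2)]) (auto simp: A_def)
    then show "x \<in> W" using r by (simp add: A_def)
  qed
  ultimately show thesis by (rule that)
qed

lemma continuous_linear_bounded_above: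
  fixes f :: "'a::topological_real_vector \<Rightarrow> real"
  assumes f: "linear f" and W: "open W" "0 \<in> W" "\<And>x. x \<in> W \<Longrightarrow> f x < 1"
  shows "continuous_on UNIV f"
proof -
  have "(f \<longlongrightarrow> f a) (at a)" for a
  proof (rule tendstoI)
    fix e :: real assume e: "e > 0"
    let ?N = "(\<lambda>x. a + e *\<^sub>R x) ` W \<inter> (\<lambda>x. a + (- e) *\<^sub>R x) ` W"
    have "open ?N" using W(1) e by (intro open_Int open_affine_image_tvs) auto
    moreover have "a \<in> ?N" using W(2) by (auto intro!: image_eqI[of _ _ 0])
    moreover have "dist (f x) (f a) < e" if "x \<in> ?N" for x
    proof -
      from that obtain v w where vw: "v \<in> W" "x = a + e *\<^sub>R v" "w \<in> W" "x = a + (- e) *\<^sub>R w"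
        by blast
      have "f x = f a + e * f v"
        unfolding vw(2) by (simp only: linear_add[OF f] linear_scale[OF f] real_scaleR_def)
      moreover have "f x = f a + (- e) * f w"
        unfolding vw(4) by (simp only: linear_add[OF f] linear_scale[OF f] real_scaleR_def)
      moreover have "e * f v < e" "e * f w < e" using W(3) vw(1,3) e by simp_all
      ultimately show ?thesis by (simp add: dist_real_def abs_less_iff)
    qed
    ultimately show "\<forall>\<^sub>F x in at a. dist (f x) (f a) < e"
      unfolding eventually_at_topological by blast
  qed
  then show ?thesis by (simp add: continuous_on_def)
qed

lemma linear_pairing: "linear (dual_apply \<phi>)"
  using dual_apply[of \<phi>] by simp

lemmas pairing_linear =
  linear_add[OF linear_pairing] linear_diff[OF linear_pairing] linear_scale[OF linear_pairing]

lemma separating_dual_open: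
  fixes C :: "'a::topological_real_vector set"
  assumes C: "open C" "convex C" "y \<notin> C"
  obtains \<phi> where "\<And>z. z \<in> C \<Longrightarrow> \<langle>z - y, \<phi>\<rangle> < 0"
proof (cases "C = {}")
  case True
  then show thesis using that by blast
next
  case False
  then obtain c where c: "c \<in> C" by blast
  define W where "W = (\<lambda>x. - c + x) ` C"
  have W: "open W" "convex W" "0 \<in> W"
    using open_affine_image_tvs[OF C(1), of 1 "- c"] convex_translation[OF C(2), of "- c"] c
    by (auto simp: W_def)
  obtain p where p: "sublinear p" "\<And>x. x \<in> W \<longleftrightarrow> p x < 1"
    using sublinear_gauge[OF W] by blast
  obtain f where f: "linear f" "f \<le> p" "p (y - c) \<le> f (y - c)"
    using Hahn_Banach_sublinear_at[OF p(1)] .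
  have f_less: "f x < 1" if "x \<in> W" for x
    using that p(2) le_funD[OF f(2), of x] by fastforce
  have "continuous_on UNIV f"
    using f(1) W(1,3) f_less by (rule continuous_linear_bounded_above)
  with f(1) have f_eq: "dual_apply (Dual f) = f" by (simp add: Dual_inverse)
  have "y - c \<notin> W" using C(3) by (auto simp: W_def)
  then have ge: "1 \<le> f (y - c)" using p(2)[of "y - c"] f(3) by linarith
  show thesis
  proof (rule that[of "Dual f"])
    fix z assume "z \<in> C"
    then have "z - c \<in> W" by (auto simp: W_def)
    then have "f (z - c) < 1" by (rule f_less)
    with ge show "\<langle>z - y, Dual f\<rangle> < 0"
      unfolding f_eq by (simp add: linear_diff[OF f(1)])
  qed
qed

lemma separating_dual_closed:
  fixes C :: "'a::locally_convex_space set"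
  assumes C: "closed C" "convex C" "y \<notin> C"
  obtains \<phi> where "\<And>z. z \<in> C \<Longrightarrow> \<langle>z - y, \<phi>\<rangle> < 0"
proof -
  have "open ((\<lambda>x. - y + 1 *\<^sub>R x) ` (- C))"
    using C(1) by (intro open_affine_image_tvs) auto
  moreover have "0 \<in> (\<lambda>x. - y + 1 *\<^sub>R x) ` (- C)"
    using C(3) by (auto intro!: image_eqI[of _ _ y])
  ultimately obtain V where V: "open V" "convex V" "0 \<in> V" "V \<subseteq> (\<lambda>x. - y + 1 *\<^sub>R x) ` (- C)"
    using locally_convex by blast
  define D where "D = (\<Union>x\<in>C. \<Union>v\<in>V. {x - v})"
  have "D = (\<Union>x\<in>C. (\<lambda>v. x + (- 1) *\<^sub>R v) ` V)" by (auto simp: D_def)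
  also have "open \<dots>" using V(1) by (intro open_UN ballI open_affine_image_tvs) auto
  finally have "open D" .
  moreover have "convex D" unfolding D_def by (rule convex_differences) fact+
  moreover have "y \<notin> D" using V(4) by (force simp: D_def)
  ultimately obtain \<phi> where "\<And>z. z \<in> D \<Longrightarrow> \<langle>z - y, \<phi>\<rangle> < 0"
    using separating_dual_open by blast
  moreover have "C \<subseteq> D" using V(3) by (force simp: D_def)
  ultimately show thesis by (intro that) blast
qed

lemma convex_combination_mem_interior:
  fixes C :: "'a::topological_real_vector set"
  assumes C: "convex C" "z \<in> C" "c \<in> interior C" and t: "0 < t" "t \<le> 1"
  shows "(1 - t) *\<^sub>R z + t *\<^sub>R c \<in> interior C"
proof (rule interiorI)
  show "open ((\<lambda>w. (1 - t) *\<^sub>R z + t *\<^sub>R w) ` interior C)"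
    using t by (intro open_affine_image_tvs) auto
  show "(\<lambda>w. (1 - t) *\<^sub>R z + t *\<^sub>R w) ` interior C \<subseteq> C"
    using interior_subset[of C] t C(2) by (auto intro!: convexD[OF C(1)])
qed (use C(3) in blast)

lemma convex_interior_tvs:
  fixes C :: "'a::topological_real_vector set"
  assumes "convex C"
  shows "convex (interior C)"
  unfolding convex_alt
proof (intro ballI allI impI)
  fix x y and u :: real
  assume xy: "x \<in> interior C" "y \<in> interior C" and u: "0 \<le> u \<and> u \<le> 1"
  then show "(1 - u) *\<^sub>R x + u *\<^sub>R y \<in> interior C"
    using convex_combination_mem_interior[OF assms, of x y u] interior_subset[of C]
    by (cases "u = 0") auto
qed

lemma separating_dual_interior:
  fixes C :: "'a::topological_real_vector set"
  assumes C: "convex C" "interior C \<noteq> {}" "y \<notin> C"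
  obtains \<phi> where "\<phi> \<noteq> 0" "\<And>z. z \<in> C \<Longrightarrow> \<langle>z - y, \<phi>\<rangle> \<le> 0"
proof -
  obtain \<phi> where \<phi>: "\<And>z. z \<in> interior C \<Longrightarrow> \<langle>z - y, \<phi>\<rangle> < 0"
    using separating_dual_open[OF open_interior convex_interior_tvs[OF C(1)], of y]
      C(3) interior_subset[of C] by blast
  obtain c where c: "c \<in> interior C" using C(2) by blast
  show thesis
  proof (rule that[of \<phi>])
    show "\<phi> \<noteq> 0" using \<phi>[OF c] by auto
    fix z assume z: "z \<in> C"
    have neg: "(1 - t) * \<langle>z - y, \<phi>\<rangle> + t * \<langle>c - y, \<phi>\<rangle> < 0" if "0 < t" "t \<le> 1" for t
      using \<phi>[OF convex_combination_mem_interior[OF C(1) z c that]]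
      by (simp add: pairing_linear algebra_simps)
    have "((\<lambda>t. (1 - t) * \<langle>z - y, \<phi>\<rangle> + t * \<langle>c - y, \<phi>\<rangle>) \<longlongrightarrow>
        (1 - 0) * \<langle>z - y, \<phi>\<rangle> + 0 * \<langle>c - y, \<phi>\<rangle>) (at_right 0)"
      by (intro tendsto_intros)
    moreover have "\<forall>\<^sub>F t in at_right 0. (1 - t) * \<langle>z - y, \<phi>\<rangle> + t * \<langle>c - y, \<phi>\<rangle> \<le> 0"
      using eventually_at_right_real[of 0 1] by (rule eventually_mono) (auto intro: less_imp_le neg)
    ultimately have "(1 - 0) * \<langle>z - y, \<phi>\<rangle> + 0 * \<langle>c - y, \<phi>\<rangle> \<le> 0"
      by (rule tendsto_upperbound) simp
    then show "\<langle>z - y, \<phi>\<rangle> \<le> 0" by simp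
  qed
qed

lemma ray_meets_frontier:
  fixes U :: "'a::{topological_real_vector,t2_space} set"
  assumes U: "closed U" "vbounded U" "absorbing U" and x: "x \<noteq> 0"
  obtains t where "t > 0" "t *\<^sub>R x \<in> frontier U"
proof -
  define A where "A = {t::real. t *\<^sub>R x \<in> U}"
  obtain V where V: "open V" "0 \<in> V" "x \<notin> V" using hausdorff[OF x] by blast
  obtain r where r: "r > 0" "\<And>s. \<bar>s\<bar> \<ge> r \<Longrightarrow> U \<subseteq> (*\<^sub>R) s ` V"
    using U(2) V unfolding vbounded_def absorbs_def by metis
  have A_less: "t < r" if "t \<in> A" for t
  proof (rule ccontr)
    assume "\<not> t < r"
    then have "U \<subseteq> (*\<^sub>R) t ` V" "t \<noteq> 0" using r by auto
    with that V(3) show False by (auto simp: A_def)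
  qed
  then have bdd: "bdd_above A" by (meson bdd_aboveI less_imp_le)
  obtain s where s: "s > 0" "\<And>t. \<bar>t\<bar> \<ge> s \<Longrightarrow> {x} \<subseteq> (*\<^sub>R) t ` U"
    using U(3) unfolding absorbing_def absorbs_def by metis
  have sA: "inverse s \<in> A" using s(1) s(2)[of s] by (auto simp: A_def)
  have "- A = {t. t *\<^sub>R x \<in> - U}" by (auto simp: A_def)
  then have "closed A" using open_real_line_tvs[of "- U" x] U(1) by (simp add: closed_def)
  then have Sup_A: "Sup A \<in> A" using bdd sA by (intro closed_contains_Sup) auto
  have "Sup A *\<^sub>R x \<notin> interior U"
  proof
    assume "Sup A *\<^sub>R x \<in> interior U"
    then obtain e where e: "e > 0" "ball (Sup A) e \<subseteq> {t. t *\<^sub>R x \<in> interior U}"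
      using open_real_line_tvs[OF open_interior] open_contains_ball by blast
    moreover have "Sup A + e / 2 \<in> ball (Sup A) e" using e(1) by (simp add: dist_real_def)
    ultimately have "Sup A + e / 2 \<in> A" using interior_subset[of U] by (auto simp: A_def)
    then have "Sup A + e / 2 \<le> Sup A" by (rule cSup_upper[OF _ bdd])
    with e(1) show False by simp
  qed
  then have "Sup A *\<^sub>R x \<in> frontier U"
    using Sup_A closure_subset[of U] by (auto simp: frontier_def A_def)
  moreover have "Sup A > 0"
    using cSup_upper[OF sA bdd] s(1) by (simp add: less_le_trans[of 0 "inverse s"])
  ultimately show thesis by (rule that[rotated])
qed

theorem theorem11:
  fixes f :: "'x::locally_convex_space \<Rightarrow> 'y::locally_convex_space set"
    and D G :: "'x set"
    and U :: "'y dual set"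
    and y :: 'y
  assumes "multimap_on D f"
    and "convex U" "closed U" "vbounded U" "absorbing U"
    and "G \<subseteq> D" "G \<noteq> {}"
    and "convex (multi_image f G)"
    and "(interior (multi_image f G) \<noteq> {} \<and>
          (\<forall>\<phi>\<in>frontier U. \<exists>x\<in>G. {\<langle>z - y, \<phi>\<rangle> | z. z \<in> f x} \<inter> {0<..} \<noteq> {})) \<or>
         ((open (multi_image f G) \<or> closed (multi_image f G)) \<and>
          (\<forall>\<phi>\<in>frontier U. \<exists>x\<in>G. {\<langle>z - y, \<phi>\<rangle> | z. z \<in> f x} \<inter> {0..} \<noteq> {}))"
  shows "y \<in> multi_image f G \<and>
    (\<exists>x\<^sub>1\<in>G. y \<in> f x\<^sub>1) \<and>
    (single_valued_on D f \<longrightarrow> (\<exists>x\<^sub>1\<in>G. f x\<^sub>1 = {y}))"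
proof -
  let ?C = "multi_image f G"
  have "y \<in> ?C"
  proof (rule ccontr)
    assume y: "y \<notin> ?C"
    show False
    proof (rule disjE[OF assms(9)]; elim conjE)
      assume ne: "interior ?C \<noteq> {}" and
        hit: "\<forall>\<phi>\<in>frontier U. \<exists>x\<in>G. {\<langle>z - y, \<phi>\<rangle> | z. z \<in> f x} \<inter> {0<..} \<noteq> {}"
      obtain \<phi> where \<phi>: "\<phi> \<noteq> 0" "\<And>z. z \<in> ?C \<Longrightarrow> \<langle>z - y, \<phi>\<rangle> \<le> 0"
        using separating_dual_interior[OF assms(8) ne y] by blast
      obtain t where t: "t > 0" "t *\<^sub>R \<phi> \<in> frontier U"
        using ray_meets_frontier[OF assms(3-5) \<phi>(1)] .
      obtain z where z: "z \<in> ?C" "t * \<langle>z - y, \<phi>\<rangle> > 0"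
        using bspec[OF hit t(2)] by (auto simp: multi_image_def)
      with \<phi>(2)[OF z(1)] t(1) show False by (simp add: zero_less_mult_iff)
    next
      assume oc: "open ?C \<or> closed ?C" and
        hit: "\<forall>\<phi>\<in>frontier U. \<exists>x\<in>G. {\<langle>z - y, \<phi>\<rangle> | z. z \<in> f x} \<inter> {0..} \<noteq> {}"
      obtain \<phi> where \<phi>: "\<And>z. z \<in> ?C \<Longrightarrow> \<langle>z - y, \<phi>\<rangle> < 0"
        using oc separating_dual_open[OF _ assms(8) y] separating_dual_closed[OF _ assms(8) y]
        by blast
      have "?C \<noteq> {}"
        using assms(1,6,7) by (force simp: multi_image_def multimap_on_def)
      then have "\<phi> \<noteq> 0" using \<phi> by force
      then obtain t where t: "t > 0" "t *\<^sub>R \<phi> \<in> frontier U"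
        using ray_meets_frontier[OF assms(3-5)] by blast
      obtain z where z: "z \<in> ?C" "t * \<langle>z - y, \<phi>\<rangle> \<ge> 0"
        using bspec[OF hit t(2)] by (auto simp: multi_image_def)
      with \<phi>[OF z(1)] t(1) show False by (simp add: zero_le_mult_iff)
    qed
  qed
  then obtain x where x: "x \<in> G" "y \<in> f x" by (auto simp: multi_image_def)
  moreover have "f x = {y}" if "single_valued_on D f"
    using that x assms(6) by (fastforce simp: single_valued_on_def)
  ultimately show ?thesis by (auto simp: multi_image_def)
qed

end
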